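(* Let $V$ be a set of $n$ nodes and $T\in\mathbb{N}^{n\times n}$ a transaction matrix on $V$. Let $G_{opt}=(V,E_{opt})$ together with the fee assignment $f_{E_{opt}}$ be an optimal solution of the CNDF problem for $T$, i.e., a pair maximizing the profit $p(G,T,f_E)$ over all graphs $G=(V,E)$ and all fee assignments $f_E\in[0,1]^E$. Let $S=(V_S,E_S)$ be the star graph with $V_S=V\cup\{c\}$, where $c\notin V$ is an additional node that is the center of the star and is joined to every node of $V$, with uniform fees $f_e=0.5$ for all $e\in E_S$. If $G_{opt}$ is connected, then $$p(S,T,f_{E_S})\ \ge\ p(G_{opt},T,f_{E_{opt}})-1 .$$
   Context: A transaction matrix on a vertex set $V$ with $|V|=n$ is a symmetric matrix $T\in\mathbb{N}^{n\times n}$ ($0\in\mathbb{N}$) with zero diagonal; $T[i,j]$ is the number of transactions between $i$ and $j$ (in either direction). A payment network is a finite simple undirected graph $G=(V,E)$ with $m=|E|$. A fee assignment $f_E$ gives each edge $e\in E$ a real fee $f_e$ with $0\le f_e\le 1$ (the value $1$ is the cost of a transaction on the blockchain). For $i,j\in V$, $path(i,j)$ denotes the edge set of a cheapest path from $i$ to $j$ in $G$, i.e., one minimizing the sum of the fees of its edges. The profit is $$p(G,T,f_E)=-m+\sum_{i,j\in V}\ \sum_{e\in path(i,j)} f_e\cdot X_{ij}\cdot T[i,j],$$ where $X_{ij}=1$ if $\sum_{e\in path(i,j)}f_e\le 1$ and $X_{ij}=0$ otherwise; pairs $i,j$ not connected in $G$ contribute $0$. For the star $S$ the profit is $-|E_S|$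 plus the same sum over $i,j\in V$ with paths taken in $S$ (the additional node $c$ takes part in no transactions). CNDF (Channels Network Design with Fees) is the problem: given $T$, return a graph $G=(V,E)$ with $|V|=n$ and a fee assignment $f_E$ such that $p(G,T,f_E)$ is maximized. *)

theory Defs
  imports Complex_Main
begin

definition simple_graph :: "'a set \<Rightarrow> 'a set set \<Rightarrow> bool" where
  "simple_graph V E \<longleftrightarrow> finite V \<and> E \<subseteq> {{u, v} | u v. u \<in> V \<and> v \<in> V \<and> u \<noteq> v}"

definition transaction_matrix :: "'a set \<Rightarrow> ('a \<Rightarrow> 'a \<Rightarrow> nat) \<Rightarrow> bool" where
  "transaction_matrix V T \<longleftrightarrow>
     (\<forall>i\<in>V. \<forall>j\<in>V. T i j = T j i) \<and> (\<forall>i\<in>V. T i i = 0)"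

(* Only the values of f on E matter; the value 1 is the cost of a blockchain transaction. *)
definition fee_assignment :: "'a set set \<Rightarrow> ('a set \<Rightarrow> real) \<Rightarrow> bool" where
  "fee_assignment E f \<longleftrightarrow> (\<forall>e\<in>E. 0 \<le> f e \<and> f e \<le> 1)"

definition path_edges :: "'a list \<Rightarrow> 'a set set" where
  "path_edges xs = {{xs ! k, xs ! Suc k} | k. Suc k < length xs}"

definition is_path :: "'a set \<Rightarrow> 'a set set \<Rightarrow> 'a \<Rightarrow> 'a \<Rightarrow> 'a list \<Rightarrow> bool" where
  "is_path V E i j xs \<longleftrightarrow>
     xs \<noteq> [] \<and> hd xs = i \<and> last xs = j \<and> distinct xs \<and> set xs \<subseteq> V \<and> path_edges xs \<subseteq> E"

definition joined :: "'a set \<Rightarrow> 'a set set \<Rightarrow> 'a \<Rightarrow> 'a \<Rightarrow> bool" where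
  "joined V E i j \<longleftrightarrow> (\<exists>xs. is_path V E i j xs)"

definition connected_graph :: "'a set \<Rightarrow> 'a set set \<Rightarrow> bool" where
  "connected_graph V E \<longleftrightarrow> (\<forall>i\<in>V. \<forall>j\<in>V. joined V E i j)"

definition cheapest_path ::
  "'a set \<Rightarrow> 'a set set \<Rightarrow> ('a set \<Rightarrow> real) \<Rightarrow> 'a \<Rightarrow> 'a \<Rightarrow> 'a list \<Rightarrow> bool" where
  "cheapest_path V E f i j xs \<longleftrightarrow>
     is_path V E i j xs \<and>
     (\<forall>ys. is_path V E i j ys \<longrightarrow> sum f (path_edges xs) \<le> sum f (path_edges ys))"

(* The edge set of an arbitrarily chosen cheapest path; meaningful only when i and j are
   joined. Its total fee does not depend on the choice. *)
definition path ::
  "'a set \<Rightarrow> 'a set set \<Rightarrow> ('a set \<Rightarrow> real) \<Rightarrow> 'a \<Rightarrow> 'a \<Rightarrow> 'a set set" where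
  "path V E f i j = path_edges (SOME xs. cheapest_path V E f i j xs)"

definition X ::
  "'a set \<Rightarrow> 'a set set \<Rightarrow> ('a set \<Rightarrow> real) \<Rightarrow> 'a \<Rightarrow> 'a \<Rightarrow> real" where
  "X V E f i j = (if (\<Sum>e\<in>path V E f i j. f e) \<le> 1 then 1 else 0)"

(* Profit of the payment network (W, E) when the transacting nodes are those of V.
   W = V for an ordinary payment network; W = V \<union> {c} for the star with added center c.
   The sum runs over ordered pairs (i, j). *)
definition profit ::
  "'a set \<Rightarrow> 'a set \<Rightarrow> 'a set set \<Rightarrow> ('a \<Rightarrow> 'a \<Rightarrow> nat) \<Rightarrow> ('a set \<Rightarrow> real) \<Rightarrow> real" where
  "profit V W E T f =
     - real (card E) +
     (\<Sum>i\<in>V. \<Sum>j\<in>V.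
        if joined W E i j
        then \<Sum>e\<in>path W E f i j. f e * X W E f i j * real (T i j)
        else 0)"

definition cndf_optimal ::
  "'a set \<Rightarrow> ('a \<Rightarrow> 'a \<Rightarrow> nat) \<Rightarrow> 'a set set \<Rightarrow> ('a set \<Rightarrow> real) \<Rightarrow> bool" where
  "cndf_optimal V T E f \<longleftrightarrow>
     simple_graph V E \<and> fee_assignment E f \<and>
     (\<forall>E' f'. simple_graph V E' \<and> fee_assignment E' f' \<longrightarrow>
        profit V V E' T f' \<le> profit V V E T f)"

definition star_edges :: "'a set \<Rightarrow> 'a \<Rightarrow> 'a set set" where
  "star_edges V c = {{c, v} | v. v \<in> V}"

end

theory Submission
  imports Defs
begin

text \<open>
  No pair contributes more than \<open>T i j\<close> to the profit of any network, because a transaction is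
  routed only if its fees total at most 1; and a connected graph has at least \<open>n - 1\<close> edges.
  The star attains \<open>T i j\<close> for every pair, since its unique path between two nodes costs
  \<open>1/2 + 1/2 = 1\<close>, and it pays for \<open>n\<close> edges, one more than the lower bound.
\<close>

lemma path_edges_singleton [simp]: "path_edges [x] = {}"
  by (auto simp: path_edges_def)

lemma path_edges_Cons2 [simp]:
  "path_edges (x # y # xs) = insert {x, y} (path_edges (y # xs))"
proof -
  have "{{(x # y # xs) ! k, (x # y # xs) ! Suc k} | k. Suc k < length (x # y # xs)}
    = insert {x, y} {{(y # xs) ! k, (y # xs) ! Suc k} | k. Suc k < length (y # xs)}"
    (is "?L = ?R")
  proof (intro set_eqI iffI)
    fix e assume "e \<in> ?L"
    then obtain k where "e = {(x # y # xs) ! k, (x # y # xs) ! Suc k}"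
      "Suc k < length (x # y # xs)" by blast
    then show "e \<in> ?R" by (cases k) auto
  next
    fix e assume "e \<in> ?R"
    then consider "e = {x, y}"
      | k where "e = {(y # xs) ! k, (y # xs) ! Suc k}" "Suc k < length (y # xs)" by blast
    then show "e \<in> ?L"
    proof cases
      case 1
      then show ?thesis by (auto intro!: exI[of _ 0])
    next
      case (2 k)
      then show ?thesis by (auto intro!: exI[of _ "Suc k"])
    qed
  qed
  then show ?thesis by (simp add: path_edges_def)
qed

text \<open>Distinct endpoints force at least one edge; peeling it off leaves a path from the next
  vertex.\<close>

lemma is_path_ConsE:
  assumes "is_path V E i j xs" and "i \<noteq> j"
  obtains y ys where "xs = i # y # ys" and "{i, y} \<in> E" and "i \<noteq> y"
    and "is_path V E y j (y # ys)"
  using assms by (cases xs; cases "tl xs") (auto simp: is_path_def split: if_splits)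

lemma finite_simple_graph: "simple_graph V E \<Longrightarrow> finite E"
  unfolding simple_graph_def
  by (rule finite_subset[of _ "Pow V"]) auto

text \<open>
  Mapping each vertex other than a root to the first edge of a shortest path to the root is
  injective, because the distance to the root drops along that edge.
\<close>

lemma connected_graph_card_le:
  assumes "simple_graph V E" and "connected_graph V E"
  shows "card V \<le> Suc (card E)"
proof (cases "V = {}")
  case False
  then obtain r where r: "r \<in> V" by blast
  \<comment> \<open>For \<open>v\<close> in \<open>V\<close>, \<open>d v\<close> counts the vertices
    of a shortest path to \<open>r\<close>, hence the distance plus one; connectedness guarantees
    that the minimum is over a nonempty set.\<close>
  define d where "d v = (LEAST n. \<exists>xs. is_path V E v r xs \<and> length xs = n)" for v
  have "\<exists>y. {v, y} \<in> E \<and> d y < d v" if v: "v \<in> V - {r}" for v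
  proof -
    have "\<exists>n xs. is_path V E v r xs \<and> length xs = n"
      using assms(2) r v by (auto simp: connected_graph_def joined_def)
    from LeastI_ex[OF this] obtain xs where xs: "is_path V E v r xs" "length xs = d v"
      unfolding d_def by blast
    from xs(1) v obtain y ys where y: "xs = v # y # ys" "{v, y} \<in> E" "is_path V E y r (y # ys)"
      by (auto elim: is_path_ConsE)
    have "d y \<le> length (y # ys)"
      unfolding d_def by (rule Least_le) (use y(3) in blast)
    then show ?thesis using y(1,2) xs(2) by auto
  qed
  then obtain p where p: "{v, p v} \<in> E" "d (p v) < d v" if "v \<in> V - {r}" for v
    by metis
  \<comment> \<open>If distinct \<open>v\<close> and \<open>w\<close> had the same edge, then
    \<open>p v = w\<close> and \<open>p w = v\<close>, so \<open>d\<close> would strictly drop both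
    ways.\<close>
  have "inj_on (\<lambda>v. {v, p v}) (V - {r})"
    by (rule inj_onI) (metis p(2) doubleton_eq_iff not_less_iff_gr_or_eq)
  then have "card (V - {r}) \<le> card E"
    by (rule card_inj_on_le) (use p(1) assms(1) in \<open>auto simp: finite_simple_graph\<close>)
  then show ?thesis using r by (simp add: card_Diff_singleton)
qed simp

lemma profit_le_total_transactions:
  "profit V W E T f \<le> - real (card E) + (\<Sum>i\<in>V. \<Sum>j\<in>V. real (T i j))"
proof -
  have "(if joined W E i j
        then \<Sum>e\<in>path W E f i j. f e * X W E f i j * real (T i j) else 0) \<le> real (T i j)" for i j
  proof -
    have "(\<Sum>e\<in>path W E f i j. f e * X W E f i j * real (T i j))
        = (\<Sum>e\<in>path W E f i j. f e) * X W E f i j * real (T i j)"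
      by (simp add: sum_distrib_right)
    \<comment> \<open>Either the fee total is at most 1 and \<open>X\<close> is 1, or
      \<open>X\<close> is 0 and the product vanishes.\<close>
    also have "\<dots> \<le> 1 * real (T i j)"
      by (rule mult_right_mono) (auto simp: X_def)
    finally show ?thesis by simp
  qed
  then show ?thesis
    unfolding profit_def by (intro add_left_mono sum_mono)
qed

lemma card_star_edges:
  assumes "c \<notin> V"
  shows "card (star_edges V c) = card V"
proof -
  have "star_edges V c = (\<lambda>v. {c, v}) ` V" by (auto simp: star_edges_def)
  then show ?thesis by (simp add: card_image inj_on_def doubleton_eq_iff)
qed

text \<open>Every edge contains \<open>c\<close>, so a path leaves \<open>i\<close> towards
  \<open>c\<close>, and any edge after the next vertex would return to \<open>c\<close>, against
  distinctness.\<close>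

lemma is_path_star_iff:
  assumes "c \<notin> V" "i \<in> V" "j \<in> V" "i \<noteq> j"
  shows "is_path (insert c V) (star_edges V c) i j xs \<longleftrightarrow> xs = [i, c, j]"
proof
  assume xs: "is_path (insert c V) (star_edges V c) i j xs"
  then obtain y ys where 1: "xs = i # y # ys" "{i, y} \<in> star_edges V c"
      "is_path (insert c V) (star_edges V c) y j (y # ys)"
    using assms(4) by (rule is_path_ConsE)
  have y: "y = c" using 1(2) assms by (auto simp: star_edges_def doubleton_eq_iff)
  then have "y \<noteq> j" using assms by auto
  with 1(3) obtain z zs where 2: "ys = z # zs" "c \<noteq> z"
      "is_path (insert c V) (star_edges V c) z j (z # zs)"
    using y by (auto elim: is_path_ConsE)
  have "z = j"
  proof (rule ccontr)
    assume "z \<noteq> j"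
    with 2(3) obtain w ws where 3: "zs = w # ws" "{z, w} \<in> star_edges V c"
      by (auto elim: is_path_ConsE)
    then have "w = c" using 2(2) by (auto simp: star_edges_def doubleton_eq_iff)
    then show False using xs 1(1) 2(1) 3(1) y by (auto simp: is_path_def)
  qed
  moreover have "zs = []"
    using 2(3) \<open>z = j\<close> by (auto simp: is_path_def split: if_splits)
  ultimately show "xs = [i, c, j]" using 1(1) 2(1) y by simp
next
  assume "xs = [i, c, j]"
  then show "is_path (insert c V) (star_edges V c) i j xs"
    using assms by (auto simp: is_path_def star_edges_def)
qed

lemma profit_star:
  assumes "transaction_matrix V T" "c \<notin> V"
  shows "profit V (insert c V) (star_edges V c) T (\<lambda>_. 1 / 2)
    = - real (card V) + (\<Sum>i\<in>V. \<Sum>j\<in>V. real (T i j))"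
proof -
  let ?W = "insert c V" and ?S = "star_edges V c" and ?f = "\<lambda>_ :: 'a set. 1 / 2 :: real"
  have "(if joined ?W ?S i j
      then \<Sum>e\<in>path ?W ?S ?f i j. ?f e * X ?W ?S ?f i j * real (T i j) else 0) = real (T i j)"
    if ij: "i \<in> V" "j \<in> V" for i j
  proof (cases "i = j")
    \<comment> \<open>Both sides vanish on the diagonal, since \<open>T i i = 0\<close>.\<close>
    case True
    then show ?thesis using assms(1) ij by (simp add: transaction_matrix_def)
  next
    case False
    note iff = is_path_star_iff[OF assms(2) ij False]
    \<comment> \<open>Uniqueness of the path determines the choice made by \<open>SOME\<close> in
      \<open>path\<close>.\<close>
    have "cheapest_path ?W ?S ?f i j xs \<longleftrightarrow> xs = [i, c, j]" for xs
      by (auto simp: cheapest_path_def iff)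
    then have path: "path ?W ?S ?f i j = {{i, c}, {c, j}}"
      by (simp add: path_def)
    \<comment> \<open>The sum runs over a set of edges, so they must differ for both halves to
      count; the total is then exactly 1, which \<open>X\<close> still admits.\<close>
    have "{i, c} \<noteq> {c, j}" using False by (auto simp: doubleton_eq_iff)
    then show ?thesis by (simp add: joined_def iff path X_def)
  qed
  then show ?thesis
    by (simp add: profit_def card_star_edges[OF assms(2)] cong: sum.cong)
qed

theorem theorem3:
  fixes V :: "'a set" and c :: 'a
    and T :: "'a \<Rightarrow> 'a \<Rightarrow> nat"
    and E_opt :: "'a set set" and f_opt :: "'a set \<Rightarrow> real"
  assumes "finite V"
    and "transaction_matrix V T"
    and "cndf_optimal V T E_opt f_opt"
    and "c \<notin> V"
    and "connected_graph V E_opt"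
  shows "profit V (insert c V) (star_edges V c) T (\<lambda>_. 1 / 2)
           \<ge> profit V V E_opt T f_opt - 1"
proof -
  have "simple_graph V E_opt"
    using assms(3) by (simp add: cndf_optimal_def)
  then have "card V \<le> Suc (card E_opt)"
    using assms(5) by (rule connected_graph_card_le)
  then have "real (card V) \<le> 1 + real (card E_opt)" by linarith
  moreover have "profit V V E_opt T f_opt
      \<le> - real (card E_opt) + (\<Sum>i\<in>V. \<Sum>j\<in>V. real (T i j))"
    by (rule profit_le_total_transactions)
  ultimately show ?thesis
    using profit_star[OF assms(2,4)] by linarith
qed

end
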